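(* For every $\mu>\frac12$, the Gaussian $\varphi_0(z)=\frac{1}{\sqrt{\pi}}e^{-|z|^2/2}$ is a global minimizer of $\mathcal{G}_\mu$ over $\{u\in\mathcal{E}: M(u)=1\}$, and it is the unique one up to phase rotations: every global minimizer is of the form $e^{i\gamma}\varphi_0$ with $\gamma\in\mathbb{R}$. The condition $\mu>\frac12$ is optimal, in the sense that for $0<\mu<\frac12$ the function $\varphi_0$ is not a global minimizer of $\mathcal{G}_\mu$ over $\{u\in\mathcal{E}: M(u)=1\}$.
   Context: $L$ denotes Lebesgue measure on $\mathbb{C}$. The Bargmann-Fock space is $\mathcal{E}=\{u(z)=e^{-|z|^2/2}f(z): f \text{ entire holomorphic on } \mathbb{C}\}\cap L^2(\mathbb{C})$. For $u\in\mathcal{E}$ set $\mathcal{H}(u)=\frac14\int_{\mathbb{C}}|u|^4\,dL$, $M(u)=\int_{\mathbb{C}}|u|^2\,dL$, $P(u)=\int_{\mathbb{C}}(|z|^2-1)|u(z)|^2\,dL(z)$ (possibly $+\infty$), and for $\mu>0$, $\mathcal{G}_\mu(u)=8\pi\mathcal{H}(u)+\mu P(u)=2\pi\int_{\mathbb{C}}|u|^4\,dL+\mu\int_{\mathbb{C}}(|z|^2-1)|u(z)|^2\,dL(z)$. A global minimizer is a $u\in\mathcal{E}$ with $M(u)=1$ and $\mathcal{G}_\mu(u)\le\mathcal{G}_\mu(v)$ for all $v\in\mathcal{E}$ with $M(v)=1$. *)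

theory Defs
  imports "HOL-Complex_Analysis.Complex_Analysis"
begin

definition bargmann_fock :: "(complex \<Rightarrow> complex) set" where
  "bargmann_fock =
    {u. (\<exists>f. f holomorphic_on UNIV \<and> (\<forall>z. u z = of_real (exp (- (cmod z)\<^sup>2 / 2)) * f z)) \<and>
        integrable lborel (\<lambda>z. (cmod (u z))\<^sup>2)}"

(* Extended Lebesgue integral, positive part minus negative part (ennreal truncates negative reals
   to 0). It is needed because P below may be infinite, where the Bochner integral would be 0. *)
definition ext_integral :: "(complex \<Rightarrow> real) \<Rightarrow> ereal" where
  "ext_integral g =
     enn2ereal (\<integral>\<^sup>+ z. ennreal (g z) \<partial>lborel) - enn2ereal (\<integral>\<^sup>+ z. ennreal (- g z) \<partial>lborel)"

definition fock_H :: "(complex \<Rightarrow> complex) \<Rightarrow> ereal" where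
  "fock_H u = ereal (1 / 4) * ext_integral (\<lambda>z. cmod (u z) ^ 4)"

definition fock_M :: "(complex \<Rightarrow> complex) \<Rightarrow> real" where
  "fock_M u = (\<integral>z. (cmod (u z))\<^sup>2 \<partial>lborel)"

(* For u in L^2 the negative part of the integrand has integral at most M(u), so the difference
   in ext_integral is never of the form infinity - infinity. *)
definition fock_P :: "(complex \<Rightarrow> complex) \<Rightarrow> ereal" where
  "fock_P u = ext_integral (\<lambda>z. ((cmod z)\<^sup>2 - 1) * (cmod (u z))\<^sup>2)"

definition fock_G :: "real \<Rightarrow> (complex \<Rightarrow> complex) \<Rightarrow> ereal" where
  "fock_G \<mu> u = ereal (8 * pi) * fock_H u + ereal \<mu> * fock_P u"

definition global_minimizer :: "real \<Rightarrow> (complex \<Rightarrow> complex) \<Rightarrow> bool" where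
  "global_minimizer \<mu> u \<longleftrightarrow>
     u \<in> bargmann_fock \<and> fock_M u = 1 \<and>
     (\<forall>v \<in> bargmann_fock. fock_M v = 1 \<longrightarrow> fock_G \<mu> u \<le> fock_G \<mu> v)"

definition gaussian0 :: "complex \<Rightarrow> complex" where
  "gaussian0 z = of_real (1 / sqrt pi * exp (- (cmod z)\<^sup>2 / 2))"

end

theory Submission
  imports Defs "HOL-Probability.Distributions"
begin

text \<open>
  In the coordinates z = s + t, w = s - t, the two-particle function u(z) u(w) is, for fixed s, the
  Gaussian exp(-|s|^2 - |t|^2) times an entire function of t that is even. Expanding it in powers
  of t, only the weights m = 0, 2, 4, ... of the relative angular momentum occur. The term m = 0
  is f(s)^2, which yields the quartic energy, and for the others m / 2 - 1 \<ge> 0. Integrated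
  over s this gives M^2 \<le> 8 pi H + (M P - |Q|^2) / 2 with Q the integral of z |u|^2. For M = 1 the
  energy at \<mu> = 1/2 is therefore at least 1, its value at the Gaussian; for larger \<mu> equality
  forces P = 0, hence f constant. Below 1/2, moving a little mass to z^2 exp(-|z|^2 / 2)
  decreases the energy.
\<close>

section \<open>Lebesgue measure on the complex plane\<close>

text \<open>Against exp(-2|t|^2) the weight |z - w|^2 / 2 = 2|t|^2 multiplies the contribution of
  t^m by m + 1. Half of (m + 1) - 3 is the factor m / 2 - 1. It is negative for m = 0, where the
  quartic term makes up the deficit exactly, and for m = 1, where nothing would; exchange symmetry
  of the two particles removes that mode. It vanishes for m = 2, so the two-particle inequality
  leaves this mode free, and uniqueness is instead read off from the surplus (\<mu> - 1/2) P. The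
  second and fourth moments may be infinite. The inequalities are therefore kept in additive form
  between integrals with values in \<open>ennreal\<close>, with |z|^2 in place of |z|^2 - 1; this is
  why 3 stands where the overview has M^2. Real numbers return only where finiteness is known.
  Orthogonality of the powers of z is obtained by averaging over rotations, so rotation invariance
  of Lebesgue measure and the law of |z|^2 replace polar coordinates.\<close>

lemma nn_integral_lborel_affine:
  fixes f :: "'a::euclidean_space \<Rightarrow> ennreal"
  assumes [measurable]: "f \<in> borel_measurable borel" and c: "c \<noteq> 0"
  shows "(\<integral>\<^sup>+ x. f x \<partial>lborel) = ennreal (\<bar>c\<bar> ^ DIM('a)) * (\<integral>\<^sup>+ x. f (t + c *\<^sub>R x) \<partial>lborel)"
  by (subst lborel_affine[OF c, of t])
     (simp add: nn_integral_density nn_integral_distr nn_integral_cmult)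

lemma nn_integral_lborel_translate:
  fixes f :: "'a::euclidean_space \<Rightarrow> ennreal"
  assumes [measurable]: "f \<in> borel_measurable borel"
  shows "(\<integral>\<^sup>+ x. f (t + x) \<partial>lborel) = (\<integral>\<^sup>+ x. f x \<partial>lborel)"
  using nn_integral_lborel_affine[OF assms, of 1 t] by simp

lemma nn_integral_lborel_reflect:
  fixes f :: "'a::euclidean_space \<Rightarrow> ennreal"
  assumes [measurable]: "f \<in> borel_measurable borel"
  shows "(\<integral>\<^sup>+ x. f (t - x) \<partial>lborel) = (\<integral>\<^sup>+ x. f x \<partial>lborel)"
  using nn_integral_lborel_affine[OF assms, of "-1" t] by simp

text \<open>
  Uniqueness of Haar measure, with the rotation-invariant unit disc B as test set: evaluate the
  double integral of the product of the indicators of B at y and of A at y + c x in both orders.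
\<close>
lemma emeasure_lborel_cmult_vimage:
  fixes c :: complex
  assumes c: "cmod c = 1" and A[measurable]: "A \<in> sets borel"
  shows "emeasure lborel ((\<lambda>x. c * x) -` A) = emeasure lborel A"
proof -
  define B :: "complex set" where "B = ball 0 1"
  have [measurable]: "B \<in> sets borel" by (simp add: B_def)
  have B: "emeasure lborel B = ennreal pi"
    unfolding B_def by (subst emeasure_ball) (auto simp: unit_ball_vol_2)
  have key: "ennreal pi * emeasure lborel ((\<lambda>x. c * x) -` A) = emeasure lborel A * ennreal pi"
  proof -
    have [measurable]: "(\<lambda>x. c * x) -` A \<in> sets borel"
      using measurable_sets_borel[of "\<lambda>x. c * x" borel A] by simp
    have "ennreal pi * emeasure lborel ((\<lambda>x. c * x) -` A)
       = (\<integral>\<^sup>+ y. indicator B y * emeasure lborel ((\<lambda>x. c * x) -` A) \<partial>lborel)"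
      by (subst nn_integral_multc) (auto simp: B)
    also have "\<dots> = (\<integral>\<^sup>+ y. \<integral>\<^sup>+ x. indicator B y * indicator A (c * x) \<partial>lborel \<partial>lborel)"
      by (intro nn_integral_cong, subst nn_integral_cmult)
         (auto simp: indicator_vimage[symmetric] simp flip: nn_integral_indicator
            intro!: arg_cong2[where f="(*)"] nn_integral_cong split: split_indicator)
    also have "\<dots> = (\<integral>\<^sup>+ y. \<integral>\<^sup>+ x. indicator B y * indicator A (y + c * x) \<partial>lborel \<partial>lborel)"
    proof (rule nn_integral_cong)
      fix y :: complex
      have e: "indicator A (y + c * x) = (indicator A (c * (y / c + x)) :: ennreal)" for x
        using c by (subst distrib_left) auto
      show "(\<integral>\<^sup>+ x. indicator B y * indicator A (c * x) \<partial>lborel)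
          = (\<integral>\<^sup>+ x. indicator B y * (indicator A (y + c * x)::ennreal) \<partial>lborel)"
        unfolding e by (rule nn_integral_lborel_translate[symmetric]) measurable
    qed
    also have "\<dots> = (\<integral>\<^sup>+ x. \<integral>\<^sup>+ y. indicator B y * indicator A (y + c * x) \<partial>lborel \<partial>lborel)"
      by (rule lborel_pair.Fubini') (simp add: borel_prod case_prod_unfold)
    also have "\<dots> = (\<integral>\<^sup>+ x. \<integral>\<^sup>+ y. indicator B (y - c * x) * indicator A y \<partial>lborel \<partial>lborel)"
    proof (rule nn_integral_cong)
      fix x
      show "(\<integral>\<^sup>+ y. indicator B y * indicator A (y + c * x) \<partial>lborel)
          = (\<integral>\<^sup>+ y. indicator B (y - c * x) * (indicator A y :: ennreal) \<partial>lborel)"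
        by (subst nn_integral_lborel_translate[of "\<lambda>y. indicator B (y - c * x) * indicator A y" "c * x", symmetric])
           (auto simp: add.commute)
    qed
    also have "\<dots> = (\<integral>\<^sup>+ y. \<integral>\<^sup>+ x. indicator B (y - c * x) * indicator A y \<partial>lborel \<partial>lborel)"
      by (rule lborel_pair.Fubini'[symmetric]) (simp add: borel_prod case_prod_unfold)
    also have "\<dots> = (\<integral>\<^sup>+ y. indicator A y * ennreal pi \<partial>lborel)"
    proof (rule nn_integral_cong)
      fix y :: complex
      \<comment> \<open>Modulus one enters here: \<open>B\<close> is invariant under rotation, so
        the integral over \<open>x\<close> is the area of a reflected translate of \<open>B\<close>,
        whatever \<open>y\<close> is.\<close>
      have e: "indicator B (y - c * x) = (indicator B (y / c - x) :: ennreal)" for x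
      proof -
        have "cmod (y - c * x) = cmod (c * (y / c - x))"
          using c by (subst right_diff_distrib) auto
        then show ?thesis using c by (simp add: B_def norm_mult split: split_indicator)
      qed
      have "(\<integral>\<^sup>+ x. indicator B (y - c * x) * indicator A y \<partial>lborel)
          = (\<integral>\<^sup>+ x. indicator B (y / c - x) \<partial>lborel) * indicator A y"
        unfolding e by (subst nn_integral_multc) auto
      also have "(\<integral>\<^sup>+ x. indicator B (y / c - x) \<partial>lborel) = ennreal pi"
        by (subst nn_integral_lborel_reflect[of "indicator B"]) (auto simp: B)
      finally show "(\<integral>\<^sup>+ x. indicator B (y - c * x) * indicator A y \<partial>lborel) = indicator A y * ennreal pi"
        by (simp add: mult.commute)
    qed
    also have "\<dots> = emeasure lborel A * ennreal pi"
      by (subst nn_integral_multc) auto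
    finally show ?thesis .
  qed
  have "ennreal (1 / pi) * (ennreal pi * X) = X" for X
    by (simp add: mult.assoc[symmetric] ennreal_mult'[symmetric])
  then show ?thesis
    using arg_cong[OF key, of "\<lambda>X. ennreal (1 / pi) * X"] by (simp add: mult.commute[of _ "ennreal pi"])
qed

lemma nn_integral_lborel_rotate:
  fixes c :: complex and f :: "complex \<Rightarrow> ennreal"
  assumes c: "cmod c = 1" and [measurable]: "f \<in> borel_measurable borel"
  shows "(\<integral>\<^sup>+ z. f (c * z) \<partial>lborel) = (\<integral>\<^sup>+ z. f z \<partial>lborel)"
proof -
  have "distr lborel borel (\<lambda>z. c * z) = lborel"
    by (rule measure_eqI) (auto simp: emeasure_distr emeasure_lborel_cmult_vimage[OF c])
  then have "(\<integral>\<^sup>+ z. f z \<partial>lborel) = (\<integral>\<^sup>+ z. f z \<partial>distr lborel borel (\<lambda>z. c * z))" by simp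
  then show ?thesis by (simp add: nn_integral_distr)
qed

text \<open>The disc of radius sqrt r has area pi r, so the image of Lebesgue measure under |z|^2 is
  pi times Lebesgue measure on the half-line. Using |z|^2 rather than |z| leaves no Jacobian and
  turns Gaussian moments into Gamma integrals.\<close>

lemma nn_integral_radial:
  fixes g :: "real \<Rightarrow> ennreal"
  assumes [measurable]: "g \<in> borel_measurable borel"
  shows "(\<integral>\<^sup>+ (z::complex). g ((cmod z)\<^sup>2) \<partial>lborel) = ennreal pi * (\<integral>\<^sup>+ x. g x * indicator {0..} x \<partial>lborel)"
proof -
  define D where "D = density lborel (\<lambda>x::real. ennreal pi * indicator {..0} x)"
  have E: "emeasure D {x<..} = ennreal (if x < 0 then - pi * x else 0)" for x
  proof -
    have "emeasure D {x<..} = ennreal pi * emeasure lborel ({..0} \<inter> {x<..})"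
      unfolding D_def by (subst emeasure_density)
        (auto simp: mult.assoc nn_integral_cmult indicator_inter_arith[symmetric])
    also have "{..0} \<inter> {x<..} = {x<..0}" by auto
    finally show ?thesis by (auto simp: ennreal_mult'[symmetric])
  qed
  \<comment> \<open>The sign makes the upper half-lines have finite measure.\<close>
  have "distr lborel borel (\<lambda>z::complex. - (cmod z)\<^sup>2) = D"
  proof (rule measure_eqI_lessThan)
    fix x :: real
    have "(\<lambda>z::complex. - (cmod z)\<^sup>2) -` {x<..} = (if x < 0 then ball 0 (sqrt (- x)) else {})"
      by (auto simp: real_less_rsqrt dest: real_less_lsqrt intro: real_less_rsqrt)
         (smt (verit) norm_ge_zero real_sqrt_less_iff real_sqrt_unique power2_eq_square zero_le_square)+
    then have F: "emeasure (distr lborel borel (\<lambda>z::complex. - (cmod z)\<^sup>2)) {x<..}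
        = ennreal (if x < 0 then - pi * x else 0)"
      by (auto simp: emeasure_distr emeasure_ball unit_ball_vol_2)
    show "emeasure (distr lborel borel (\<lambda>z::complex. - (cmod z)\<^sup>2)) {x<..} = emeasure D {x<..}"
      by (simp only: E F)
    show "emeasure (distr lborel borel (\<lambda>z::complex. - (cmod z)\<^sup>2)) {x<..} < \<infinity>"
      by (simp only: F) simp
  qed (auto simp: D_def)
  then have "(\<integral>\<^sup>+ x. g (- x) \<partial>distr lborel borel (\<lambda>z::complex. - (cmod z)\<^sup>2)) = (\<integral>\<^sup>+ x. g (- x) \<partial>D)"
    by simp
  then have "(\<integral>\<^sup>+ (z::complex). g ((cmod z)\<^sup>2) \<partial>lborel) = (\<integral>\<^sup>+ x. ennreal pi * (indicator {..0} x * g (- x)) \<partial>lborel)"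
    by (simp add: nn_integral_distr D_def nn_integral_density mult.assoc)
  also have "\<dots> = ennreal pi * (\<integral>\<^sup>+ x. indicator {..0} x * g (- x) \<partial>lborel)"
    by (rule nn_integral_cmult) auto
  also have "(\<integral>\<^sup>+ x. indicator {..0} x * g (- x) \<partial>lborel) = (\<integral>\<^sup>+ x. indicator {..0} (-x) * g x \<partial>lborel)"
    using nn_integral_lborel_reflect[of "\<lambda>x. indicator {..0} x * g (- x)" 0] by simp
  also have "\<dots> = (\<integral>\<^sup>+ x. g x * indicator {0..} x \<partial>lborel)"
    by (intro nn_integral_cong) (auto split: split_indicator)
  finally show ?thesis .
qed

lemma nn_integral_gaussian_moment:
  assumes c: "c > 0"
  shows "(\<integral>\<^sup>+ (z::complex). ennreal (cmod z ^ (2 * k) * exp (- c * (cmod z)\<^sup>2)) \<partial>lborel)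
    = ennreal (pi * fact k / c ^ (k + 1))"
proof -
  have "(\<integral>\<^sup>+ (z::complex). ennreal (cmod z ^ (2 * k) * exp (- c * (cmod z)\<^sup>2)) \<partial>lborel)
    = ennreal pi * (\<integral>\<^sup>+ x. ennreal (x ^ k * exp (- c * x)) * indicator {0..} x \<partial>lborel)"
    by (subst nn_integral_radial[symmetric]) (auto simp: power_mult)
  also have "(\<integral>\<^sup>+ x. ennreal (x ^ k * exp (- c * x)) * indicator {0..} x \<partial>lborel)
    = ennreal (1 / c) * (\<integral>\<^sup>+ x. ennreal ((x / c) ^ k * exp (- x)) * indicator {0..} x \<partial>lborel)"
    using c by (subst nn_integral_real_affine[where c="1/c" and t=0])
       (auto intro!: arg_cong2[where f="(*)"] nn_integral_cong simp: field_simps split: split_indicator)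
  also have "(\<integral>\<^sup>+ x. ennreal ((x / c) ^ k * exp (- x)) * indicator {0..} x \<partial>lborel)
    = (\<integral>\<^sup>+ x. ennreal (1 / c ^ k) * (ennreal (x ^ k * exp (- x)) * indicator {0..} x) \<partial>lborel)"
    using c by (intro nn_integral_cong)
       (auto simp: ennreal_mult'[symmetric] power_divide split: split_indicator)
  also have "\<dots> = ennreal (1 / c ^ k) * ennreal (fact k)"
    by (subst nn_integral_cmult) (auto simp: nn_intergal_power_times_exp_Ici)
  finally show ?thesis using c by (simp add: ennreal_mult'[symmetric] field_simps)
qed

text \<open>The factor 4 is the real Jacobian of (s, t) -> (s + t, s - t), the square of its complex
  determinant -2 in modulus. It appears when z = w + 2t is substituted for fixed w; the later shift
  w = s - t preserves measure.\<close>

lemma nn_integral_sum_diff: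
  fixes G :: "complex \<Rightarrow> complex \<Rightarrow> ennreal"
  assumes [measurable]: "(\<lambda>(z, w). G z w) \<in> borel_measurable (borel \<Otimes>\<^sub>M borel)"
  shows "(\<integral>\<^sup>+ w. \<integral>\<^sup>+ z. G z w \<partial>lborel \<partial>lborel) = 4 * (\<integral>\<^sup>+ s. \<integral>\<^sup>+ t. G (s + t) (s - t) \<partial>lborel \<partial>lborel)"
proof -
  have [measurable]: "(\<lambda>x. G (f x) (g x)) \<in> borel_measurable M"
    if [measurable]: "f \<in> borel_measurable M" "g \<in> borel_measurable M" for f g and M :: "'x measure"
    using measurable_compose[OF measurable_Pair[OF that] assms] by simp
  have "(\<integral>\<^sup>+ w. \<integral>\<^sup>+ z. G z w \<partial>lborel \<partial>lborel) = (\<integral>\<^sup>+ w. 4 * (\<integral>\<^sup>+ t. G (w + 2 *\<^sub>R t) w \<partial>lborel) \<partial>lborel)"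
    by (intro nn_integral_cong, subst nn_integral_lborel_affine[where c=2]) auto
  also have "\<dots> = 4 * (\<integral>\<^sup>+ w. \<integral>\<^sup>+ t. G (w + 2 *\<^sub>R t) w \<partial>lborel \<partial>lborel)"
    by (rule nn_integral_cmult) measurable
  also have "(\<integral>\<^sup>+ w. \<integral>\<^sup>+ t. G (w + 2 *\<^sub>R t) w \<partial>lborel \<partial>lborel) = (\<integral>\<^sup>+ t. \<integral>\<^sup>+ w. G (w + 2 *\<^sub>R t) w \<partial>lborel \<partial>lborel)"
    by (rule lborel_pair.Fubini') (simp add: borel_prod case_prod_unfold)
  also have "\<dots> = (\<integral>\<^sup>+ t. \<integral>\<^sup>+ s. G (s + t) (s - t) \<partial>lborel \<partial>lborel)"
  proof (rule nn_integral_cong)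
    fix t
    have "(\<integral>\<^sup>+ w. G (w + 2 *\<^sub>R t) w \<partial>lborel) = (\<integral>\<^sup>+ s. G (- t + s + 2 *\<^sub>R t) (- t + s) \<partial>lborel)"
      by (rule nn_integral_lborel_translate[symmetric]) measurable
    then show "(\<integral>\<^sup>+ w. G (w + 2 *\<^sub>R t) w \<partial>lborel) = (\<integral>\<^sup>+ s. G (s + t) (s - t) \<partial>lborel)"
      by (simp add: scaleR_2 algebra_simps)
  qed
  also have "\<dots> = (\<integral>\<^sup>+ s. \<integral>\<^sup>+ t. G (s + t) (s - t) \<partial>lborel \<partial>lborel)"
    by (rule lborel_pair.Fubini'[symmetric]) (simp add: borel_prod case_prod_unfold)
  finally show ?thesis .
qed

section \<open>Gaussian moments of entire functions\<close>

text \<open>Parseval on the circle through \<open>z\<close>: the partial sums are trigonometric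
  polynomials, for which it is plain orthogonality, and they converge uniformly in the
  angle.\<close>

lemma nn_integral_circle_power_series:
  fixes h :: "complex \<Rightarrow> complex"
  assumes h: "\<And>z. (\<lambda>n. a n * z ^ n) sums h z"
  shows "(\<integral>\<^sup>+ x. ennreal ((cmod (h (cis x * z)))\<^sup>2) * indicator {0..2 * pi} x \<partial>lborel)
    = (\<Sum>n. ennreal (2 * pi * ((cmod (a n))\<^sup>2 * cmod z ^ (2 * n))))"
proof -
  define S where "S N x = (\<Sum>n<N. a n * (cis x * z) ^ n)" for N and x :: real
  have summable: "summable (\<lambda>n. cmod (a n) * cmod z ^ n)"
  proof -
    \<comment> \<open>Convergence at the larger radius |z| + 1 gives absolute convergence at
      \<open>z\<close>, hence the majorant for the Weierstrass test.\<close>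
    have "summable (\<lambda>n. cmod (a n * z ^ n))"
      by (rule powser_insidea[of a "of_real (cmod z + 1)"])
         (use h[THEN sums_summable] in auto)
    then show ?thesis by (simp add: norm_mult norm_power)
  qed
  have unif: "uniform_limit {0..2 * pi} S (\<lambda>x. h (cis x * z)) sequentially"
  proof -
    have "uniform_limit {0..2 * pi} (\<lambda>N x. \<Sum>n<N. a n * (cis x * z) ^ n)
        (\<lambda>x. \<Sum>n. a n * (cis x * z) ^ n) sequentially"
      by (rule Weierstrass_m_test[OF _ summable]) (simp add: norm_mult norm_power)
    then show ?thesis using h[THEN sums_unique] by (simp add: S_def[abs_def])
  qed
  have S_int: "((\<lambda>x. (cmod (S N x))\<^sup>2) has_integral (\<Sum>n<N. 2 * pi * ((cmod (a n))\<^sup>2 * cmod z ^ (2 * n)))) {0..2 * pi}" for N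
  proof -
    \<comment> \<open>\<open>T m n\<close> is the cross term of modes m and n in the expansion of
      |\<open>S N\<close>|^2; for distinct modes it has a nonzero integer frequency.\<close>
    define T where "T m n x = a m * z ^ m * cnj (a n * z ^ n) * cis ((real m - real n) * x)" for m n x
    have T: "(T m n has_integral (if m = n then 2 * pi * ((cmod (a n))\<^sup>2 * cmod z ^ (2 * n)) else 0)) {0..2 * pi}" for m n
    proof (cases "m = n")
      case True
      have "T n n = (\<lambda>x. complex_of_real ((cmod (a n))\<^sup>2 * cmod z ^ (2 * n)))"
      proof
        fix x
        have "T n n x = complex_of_real ((cmod (a n * z ^ n))\<^sup>2)"
          unfolding complex_norm_square by (simp add: T_def)
        then show "T n n x = complex_of_real ((cmod (a n))\<^sup>2 * cmod z ^ (2 * n))"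
          by (simp add: norm_mult norm_power power_mult_distrib power_mult[symmetric] mult.commute)
      qed
      then show ?thesis
        using has_integral_const_real[of "complex_of_real ((cmod (a n))\<^sup>2 * cmod z ^ (2 * n))" 0 "2 * pi"] True
        by (simp add: scaleR_conv_of_real)
    next
      case False
      define k where "k = real m - real n"
      have k: "k \<noteq> 0" and kint: "cis (k * (2 * pi)) = 1"
        using False by (auto simp: k_def cis_conv_exp exp_eq_1 left_diff_distrib intro!: exI[of _ "int m - int n"])
      have "((\<lambda>x. cis (k * x)) has_integral (cis (k * (2 * pi)) / (\<i> * k) - cis (k * 0) / (\<i> * k))) {0..2 * pi}"
      proof (rule fundamental_theorem_of_calculus)
        fix x :: real
        have "((\<lambda>w. exp (\<i> * k * w) / (\<i> * k)) has_field_derivative exp (\<i> * k * of_real x)) (at (of_real x))"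
          using k by (auto intro!: derivative_eq_intros)
        then show "((\<lambda>x. cis (k * x) / (\<i> * k)) has_vector_derivative cis (k * x)) (at x within {0..2 * pi})"
          by (auto dest!: has_vector_derivative_real_field simp: cis_conv_exp mult.assoc)
      qed simp
      then have "((\<lambda>x. cis (k * x)) has_integral 0) {0..2 * pi}" by (simp add: kint)
      from has_integral_mult_right[OF this, of "a m * z ^ m * cnj (a n * z ^ n)"]
      show ?thesis using False by (simp add: T_def[abs_def] k_def)
    qed
    have "complex_of_real ((cmod (S N x))\<^sup>2) = (\<Sum>m<N. \<Sum>n<N. T m n x)" for x
      unfolding complex_norm_square S_def cnj_sum sum_product T_def
      by (intro sum.cong refl)
         (simp add: power_mult_distrib Complex.DeMoivre cis_cnj cis_divide[symmetric] left_diff_distrib divide_inverse cis_inverse)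
    moreover have "((\<lambda>x. \<Sum>m<N. \<Sum>n<N. T m n x) has_integral
      (\<Sum>m<N. \<Sum>n<N. (if m = n then 2 * pi * ((cmod (a n))\<^sup>2 * cmod z ^ (2 * n)) else 0))) {0..2 * pi}"
      unfolding of_real_sum by (intro has_integral_sum T) auto
    ultimately have "((\<lambda>x. complex_of_real ((cmod (S N x))\<^sup>2)) has_integral
       complex_of_real (\<Sum>n<N. 2 * pi * ((cmod (a n))\<^sup>2 * cmod z ^ (2 * n)))) {0..2 * pi}"
      by (simp add: sum.delta)
    from has_integral_Re[OF this] show ?thesis by simp
  qed
  \<comment> \<open>Squaring preserves a uniform limit only when the limit is bounded.\<close>
  have bdd: "bounded ((\<lambda>x. h (cis x * z)) ` {0..2 * pi})"
  proof (rule compact_imp_bounded, rule compact_continuous_image)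
    show "continuous_on {0..2 * pi} (\<lambda>x. h (cis x * z))"
      by (rule uniform_limit_theorem[OF _ unif]) (auto simp: S_def intro!: always_eventually continuous_intros)
  qed simp
  have "uniform_limit {0..2 * pi} (\<lambda>N x. (cmod (S N x))\<^sup>2) (\<lambda>x. (cmod (h (cis x * z)))\<^sup>2) sequentially"
  proof -
    have n: "uniform_limit {0..2 * pi} (\<lambda>N x. cmod (S N x)) (\<lambda>x. cmod (h (cis x * z))) sequentially"
      by (rule uniform_limit_intros unif)+
    have b: "bounded ((\<lambda>x. cmod (h (cis x * z))) ` {0..2 * pi})"
      using bdd by (auto simp: bounded_iff)
    show ?thesis unfolding power2_eq_square
      by (rule uniform_lim_mult[OF n n b b])
  qed
  then obtain I J where I: "\<And>N. ((\<lambda>x. (cmod (S N x))\<^sup>2) has_integral I N) {0..2 * pi}"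
    and J: "((\<lambda>x. (cmod (h (cis x * z)))\<^sup>2) has_integral J) {0..2 * pi}" and lim: "I \<longlonglongrightarrow> J"
    by (rule uniform_limit_integral) (auto simp: S_def intro!: continuous_intros)
  have "I = (\<lambda>N. \<Sum>n<N. 2 * pi * ((cmod (a n))\<^sup>2 * cmod z ^ (2 * n)))"
    using has_integral_unique[OF I S_int] by auto
  with lim have sums: "(\<lambda>n. 2 * pi * ((cmod (a n))\<^sup>2 * cmod z ^ (2 * n))) sums J"
    by (simp add: sums_def)
  have "(\<integral>\<^sup>+ x. ennreal ((cmod (h (cis x * z)))\<^sup>2) * indicator {0..2 * pi} x \<partial>lborel) = ennreal J"
    by (rule nn_integral_has_integral_lebesgue'[OF _ J]) simp
  also have "\<dots> = (\<Sum>n. ennreal (2 * pi * ((cmod (a n))\<^sup>2 * cmod z ^ (2 * n))))"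
    using sums by (simp add: suminf_ennreal2 sums_iff)
  finally show ?thesis .
qed

text \<open>The area integral does not change under z -> \<open>cis x * z\<close>, so it may be
  averaged over x. After Tonelli the inner integral runs over a circle, where Parseval removes all
  cross terms.\<close>

lemma nn_integral_power_series_radial:
  fixes h :: "complex \<Rightarrow> complex" and g :: "real \<Rightarrow> ennreal"
  assumes h: "\<And>z. (\<lambda>n. a n * z ^ n) sums h z" and [measurable]: "h \<in> borel_measurable borel"
    and [measurable]: "g \<in> borel_measurable borel"
  shows "(\<integral>\<^sup>+ z. g (cmod z) * ennreal ((cmod (h z))\<^sup>2) \<partial>lborel)
    = (\<Sum>n. ennreal ((cmod (a n))\<^sup>2) * (\<integral>\<^sup>+ (z::complex). g (cmod z) * ennreal (cmod z ^ (2 * n)) \<partial>lborel))"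
    (is "?I = ?S")
proof -
  have [measurable]: "cis \<in> borel_measurable borel"
    by (intro borel_measurable_continuous_onI continuous_intros)
  have "ennreal (2 * pi) * ?I = (\<integral>\<^sup>+ x. ?I * indicator {0..2 * pi} (x::real) \<partial>lborel)"
    by (subst nn_integral_cmult) (auto simp: mult.commute)
  also have "\<dots> = (\<integral>\<^sup>+ x. \<integral>\<^sup>+ z. g (cmod z) * ennreal ((cmod (h (cis x * z)))\<^sup>2) * indicator {0..2 * pi} x \<partial>lborel \<partial>lborel)"
  proof (rule nn_integral_cong)
    fix x :: real
    have "(\<integral>\<^sup>+ z. g (cmod (cis x * z)) * ennreal ((cmod (h (cis x * z)))\<^sup>2) \<partial>lborel) = ?I"
      by (rule nn_integral_lborel_rotate[where f="\<lambda>z. g (cmod z) * ennreal ((cmod (h z))\<^sup>2)"]) auto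
    then have "?I = (\<integral>\<^sup>+ z. g (cmod z) * ennreal ((cmod (h (cis x * z)))\<^sup>2) \<partial>lborel)"
      by (simp add: norm_mult)
    then show "?I * indicator {0..2 * pi} x = (\<integral>\<^sup>+ z. g (cmod z) * ennreal ((cmod (h (cis x * z)))\<^sup>2) * indicator {0..2 * pi} x \<partial>lborel)"
      by (subst nn_integral_multc) auto
  qed
  also have "\<dots> = (\<integral>\<^sup>+ z. \<integral>\<^sup>+ x. g (cmod z) * ennreal ((cmod (h (cis x * z)))\<^sup>2) * indicator {0..2 * pi} x \<partial>lborel \<partial>lborel)"
    by (rule lborel_pair.Fubini') (simp add: borel_prod case_prod_unfold)
  also have "\<dots> = (\<integral>\<^sup>+ z. g (cmod z) * (\<Sum>n. ennreal (2 * pi * ((cmod (a n))\<^sup>2 * cmod z ^ (2 * n)))) \<partial>lborel)"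
    by (rule nn_integral_cong, subst nn_integral_circle_power_series[OF h, symmetric],
        subst nn_integral_cmult[symmetric]) (auto simp: mult.assoc)
  also have "\<dots> = (\<integral>\<^sup>+ (z::complex). (\<Sum>n. ennreal (2 * pi) * (ennreal ((cmod (a n))\<^sup>2) * (g (cmod z) * ennreal (cmod z ^ (2 * n))))) \<partial>lborel)"
    unfolding ennreal_suminf_cmult[symmetric]
    by (simp add: ennreal_mult' mult_ac)
  also have "\<dots> = (\<Sum>n. \<integral>\<^sup>+ (z::complex). ennreal (2 * pi) * (ennreal ((cmod (a n))\<^sup>2) * (g (cmod z) * ennreal (cmod z ^ (2 * n)))) \<partial>lborel)"
    by (rule nn_integral_suminf) measurable
  also have "\<dots> = ennreal (2 * pi) * ?S"
    by (simp add: nn_integral_cmult)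
  finally have eq: "ennreal (2 * pi) * ?I = ennreal (2 * pi) * ?S" .
  have "ennreal (1 / (2 * pi)) * (ennreal (2 * pi) * X) = X" for X
    by (simp add: mult.assoc[symmetric] ennreal_mult'[symmetric])
  from arg_cong[OF eq, of "\<lambda>X. ennreal (1 / (2 * pi)) * X", unfolded this] show ?thesis .
qed

text \<open>Applied with c = 1 to |u|^2 and with c = 2 to |u|^4 and to the relative motion; j = 0
  gives masses and j = 1 second moments.\<close>

lemma nn_integral_power_series_gaussian:
  fixes h :: "complex \<Rightarrow> complex"
  assumes h: "\<And>z. (\<lambda>n. a n * z ^ n) sums h z" and m: "h \<in> borel_measurable borel" and c: "c > 0"
  shows "(\<integral>\<^sup>+ z. ennreal (cmod z ^ (2 * j) * (cmod (h z))\<^sup>2 * exp (- c * (cmod z)\<^sup>2)) \<partial>lborel)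
    = (\<Sum>n. ennreal ((cmod (a n))\<^sup>2 * (pi * fact (n + j) / c ^ (n + j + 1))))"
proof -
  have "(\<integral>\<^sup>+ z. ennreal (cmod z ^ (2 * j) * (cmod (h z))\<^sup>2 * exp (- c * (cmod z)\<^sup>2)) \<partial>lborel)
    = (\<integral>\<^sup>+ z. ennreal (cmod z ^ (2 * j) * exp (- c * (cmod z)\<^sup>2)) * ennreal ((cmod (h z))\<^sup>2) \<partial>lborel)"
    by (intro nn_integral_cong) (simp add: ennreal_mult'[symmetric] mult_ac)
  also have "\<dots> = (\<Sum>n. ennreal ((cmod (a n))\<^sup>2) *
      (\<integral>\<^sup>+ (z::complex). ennreal (cmod z ^ (2 * j) * exp (- c * (cmod z)\<^sup>2)) * ennreal (cmod z ^ (2 * n)) \<partial>lborel))"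
    by (rule nn_integral_power_series_radial[OF h m, of "\<lambda>r. ennreal (r ^ (2 * j) * exp (- c * r\<^sup>2))"]) measurable
  also have "(\<lambda>n. \<integral>\<^sup>+ (z::complex). ennreal (cmod z ^ (2 * j) * exp (- c * (cmod z)\<^sup>2)) * ennreal (cmod z ^ (2 * n)) \<partial>lborel)
      = (\<lambda>n. ennreal (pi * fact (n + j) / c ^ (n + j + 1)))"
    by (rule ext, subst nn_integral_gaussian_moment[OF c, symmetric], intro nn_integral_cong)
       (simp add: ennreal_mult'[symmetric] power_add distrib_left mult_ac)
  finally show ?thesis by (simp only: ennreal_mult'[OF zero_le_power2])
qed

text \<open>Both sides are diagonal in the Taylor coefficients, and the claim is checked mode by
  mode. The weight 2|t|^2 multiplies mode n by n + 1, which is at least 3 from n = 2 on. Mode 1 is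
  absent by the hypothesis on the derivative. Mode 0 has mass (pi / 2)|h 0|^2 and lacks twice that,
  exactly the term pi |h 0|^2.\<close>

lemma gaussian_integral_le_of_deriv_zero:
  assumes hol: "h holomorphic_on UNIV" and d: "deriv h 0 = 0"
  shows "(\<integral>\<^sup>+ t. ennreal (3 * ((cmod (h t))\<^sup>2 * exp (- 2 * (cmod t)\<^sup>2))) \<partial>lborel)
    \<le> ennreal (pi * (cmod (h 0))\<^sup>2) + (\<integral>\<^sup>+ t. ennreal (2 * (cmod t)\<^sup>2 * ((cmod (h t))\<^sup>2 * exp (- 2 * (cmod t)\<^sup>2))) \<partial>lborel)"
proof -
  define a where "a n = (deriv ^^ n) h 0 / fact n" for n
  have h: "(\<lambda>n. a n * z ^ n) sums h z" for z
    using holomorphic_power_series[of h 0 "cmod z + 1" z] hol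
    by (auto simp: a_def intro: holomorphic_on_subset)
  have m[measurable]: "h \<in> borel_measurable borel"
    by (intro borel_measurable_continuous_onI holomorphic_on_imp_continuous_on hol)
  have a0: "a 0 = h 0" and a1: "a 1 = 0" using d by (simp_all add: a_def)
  define b where "b j n = (cmod (a n))\<^sup>2 * (pi * fact (n + j) / 2 ^ (n + j + 1))" for j n
  have J: "(\<integral>\<^sup>+ t. ennreal (k * (cmod t ^ (2 * j) * (cmod (h t))\<^sup>2 * exp (- 2 * (cmod t)\<^sup>2))) \<partial>lborel) = (\<Sum>n. ennreal (k * b j n))" if "k \<ge> 0" for j k
    using that unfolding ennreal_mult'[OF that]
    by (subst nn_integral_cmult, measurable)
       (simp only: nn_integral_power_series_gaussian[OF h m zero_less_numeral] b_def ennreal_suminf_cmult)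
  have "(\<Sum>n. ennreal (3 * b 0 n)) \<le> (\<Sum>n. (if n = 0 then ennreal (pi * (cmod (h 0))\<^sup>2) else 0) + ennreal (2 * b 1 n))"
  proof (intro suminf_le summableI)
    fix n
    show "ennreal (3 * b 0 n) \<le> (if n = 0 then ennreal (pi * (cmod (h 0))\<^sup>2) else 0) + ennreal (2 * b 1 n)"
    proof (cases "n \<ge> 2")
      case True
      have "b 1 n = b 0 n * ((n + 1) / 2)" by (simp add: b_def field_simps)
      moreover have "b 0 n \<ge> 0" by (simp add: b_def)
      ultimately have "3 * b 0 n \<le> 2 * b 1 n" using True mult_left_mono[of 3 "real n + 1" "b 0 n"] by (simp add: mult.commute add.commute)
      then show ?thesis using True by (auto intro: ennreal_leI)
    next
      case False
      then have "n = 0 \<or> n = 1" by auto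
      then show ?thesis using a1
        by (auto simp: b_def a0 field_simps simp flip: ennreal_plus intro!: ennreal_leI)
    qed
  qed
  also have "\<dots> = (\<Sum>n. (if n = 0 then ennreal (pi * (cmod (h 0))\<^sup>2) else 0)) + (\<Sum>n. ennreal (2 * b 1 n))"
    by (rule suminf_add[symmetric]) auto
  also have "(\<Sum>n. (if n = 0 then ennreal (pi * (cmod (h 0))\<^sup>2) else 0)) = ennreal (pi * (cmod (h 0))\<^sup>2)"
    by (subst suminf_finite[of "{0::nat}"]) auto
  finally show ?thesis using J[of 3 0] J[of 2 1] by (simp add: mult_ac)
qed

section \<open>The two-particle inequality\<close>

lemma holomorphic_UNIV_borel_measurable:
  "f holomorphic_on UNIV \<Longrightarrow> f \<in> borel_measurable borel"
  by (intro borel_measurable_continuous_onI holomorphic_on_imp_continuous_on)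

lemma two_particle_inequality:
  fixes f :: "complex \<Rightarrow> complex"
  assumes hol: "f holomorphic_on UNIV"
  defines "U \<equiv> \<lambda>z. (cmod (f z))\<^sup>2 * exp (- (cmod z)\<^sup>2)"
  shows "3 * ((\<integral>\<^sup>+ z. ennreal (U z) \<partial>lborel) * (\<integral>\<^sup>+ z. ennreal (U z) \<partial>lborel))
    \<le> ennreal (4 * pi) * (\<integral>\<^sup>+ z. ennreal ((U z)\<^sup>2) \<partial>lborel)
      + (\<integral>\<^sup>+ w. \<integral>\<^sup>+ z. ennreal ((cmod (z - w))\<^sup>2 / 2 * U z * U w) \<partial>lborel \<partial>lborel)"
proof -
  have [measurable]: "f \<in> borel_measurable borel"
    by (rule holomorphic_UNIV_borel_measurable[OF hol])
  have [measurable]: "U \<in> borel_measurable borel" unfolding U_def by measurable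
  have U0: "U z \<ge> 0" for z by (simp add: U_def)
  define h where "h s t = f (s + t) * f (s - t)" for s t
  have h_hol: "h s holomorphic_on UNIV" for s
    unfolding h_def
    by (intro holomorphic_intros holomorphic_on_compose_gen[OF _ hol, unfolded o_def]) auto
  \<comment> \<open>\<open>h s\<close> is even in t. Only the vanishing of mode 1 is drawn from
    this; higher odd modes already satisfy the estimate.\<close>
  have h_deriv: "deriv (h s) 0 = 0" for s
  proof -
    have f': "(f has_field_derivative deriv f s) (at s)"
      using hol by (simp add: holomorphic_derivI)
    have "((\<lambda>t. f (s + t)) has_field_derivative deriv f s * 1) (at 0)"
      by (rule DERIV_chain'[where g=f]) (use f' in \<open>auto intro!: derivative_eq_intros\<close>)
    moreover have "((\<lambda>t. f (s - t)) has_field_derivative deriv f s * (-1)) (at 0)"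
      by (rule DERIV_chain'[where g=f]) (use f' in \<open>auto intro!: derivative_eq_intros\<close>)
    ultimately have "(h s has_field_derivative deriv f s * 1 * f (s - 0) + deriv f s * (-1) * f (s + 0)) (at 0)"
      unfolding h_def by (rule DERIV_mult)
    then show ?thesis by (simp add: DERIV_imp_deriv)
  qed
  \<comment> \<open>The parallelogram law splits the joint Gaussian into a factor in s and a factor
    in t, so the one-variable estimate applies for each fixed s.\<close>
  have UU: "U (s + t) * U (s - t) = exp (- 2 * (cmod s)\<^sup>2) * ((cmod (h s t))\<^sup>2 * exp (- 2 * (cmod t)\<^sup>2))" for s t
  proof -
    have "(cmod (s + t))\<^sup>2 + (cmod (s - t))\<^sup>2 = 2 * (cmod s)\<^sup>2 + 2 * (cmod t)\<^sup>2"
      unfolding cmod_power2 by (simp add: power2_eq_square algebra_simps)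
    then have "exp (- (cmod (s + t))\<^sup>2) * exp (- (cmod (s - t))\<^sup>2) = exp (- 2 * (cmod s)\<^sup>2) * exp (- 2 * (cmod t)\<^sup>2)"
      by (simp add: exp_add[symmetric])
    then show ?thesis
      by (simp add: U_def h_def norm_mult power_mult_distrib mult_ac)
  qed
  have Us: "(U s)\<^sup>2 = exp (- 2 * (cmod s)\<^sup>2) * (cmod (h s 0))\<^sup>2" for s
    using UU[of s 0] by (simp add: power2_eq_square)
  have "3 * ((\<integral>\<^sup>+ z. ennreal (U z) \<partial>lborel) * (\<integral>\<^sup>+ z. ennreal (U z) \<partial>lborel))
      = (\<integral>\<^sup>+ w. \<integral>\<^sup>+ z. ennreal (3 * (U z * U w)) \<partial>lborel \<partial>lborel)"
    using U0 by (simp add: ennreal_mult' nn_integral_cmult nn_integral_multc)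
  also have "\<dots> = 4 * (\<integral>\<^sup>+ s. \<integral>\<^sup>+ t. ennreal (3 * (U (s + t) * U (s - t))) \<partial>lborel \<partial>lborel)"
    by (rule nn_integral_sum_diff) (simp add: case_prod_unfold)
  also have "\<dots> \<le> 4 * (\<integral>\<^sup>+ s. ennreal (pi * (U s)\<^sup>2)
      + (\<integral>\<^sup>+ t. ennreal ((cmod ((s + t) - (s - t)))\<^sup>2 / 2 * U (s + t) * U (s - t)) \<partial>lborel) \<partial>lborel)"
  proof (intro mult_left_mono nn_integral_mono)
    fix s
    have [measurable]: "h s \<in> borel_measurable borel"
      by (rule holomorphic_UNIV_borel_measurable[OF h_hol])
    let ?E = "ennreal (exp (- 2 * (cmod s)\<^sup>2))"
    have "(\<integral>\<^sup>+ t. ennreal (3 * (U (s + t) * U (s - t))) \<partial>lborel)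
        = (\<integral>\<^sup>+ t. ?E * ennreal (3 * ((cmod (h s t))\<^sup>2 * exp (- 2 * (cmod t)\<^sup>2))) \<partial>lborel)"
      by (rule nn_integral_cong, subst UU) (simp add: ennreal_mult'[symmetric] mult_ac)
    also have "\<dots> = ?E * (\<integral>\<^sup>+ t. ennreal (3 * ((cmod (h s t))\<^sup>2 * exp (- 2 * (cmod t)\<^sup>2))) \<partial>lborel)"
      by (rule nn_integral_cmult) measurable
    also have "\<dots> \<le> ?E * (ennreal (pi * (cmod (h s 0))\<^sup>2)
        + (\<integral>\<^sup>+ t. ennreal (2 * (cmod t)\<^sup>2 * ((cmod (h s t))\<^sup>2 * exp (- 2 * (cmod t)\<^sup>2))) \<partial>lborel))"
      by (intro mult_left_mono gaussian_integral_le_of_deriv_zero h_hol h_deriv) simp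
    also have "\<dots> = ennreal (pi * (U s)\<^sup>2)
        + (\<integral>\<^sup>+ t. ?E * ennreal (2 * (cmod t)\<^sup>2 * ((cmod (h s t))\<^sup>2 * exp (- 2 * (cmod t)\<^sup>2))) \<partial>lborel)"
      by (subst nn_integral_cmult) (auto simp: distrib_left Us ennreal_mult'[symmetric] mult_ac)
    also have "(\<integral>\<^sup>+ t. ?E * ennreal (2 * (cmod t)\<^sup>2 * ((cmod (h s t))\<^sup>2 * exp (- 2 * (cmod t)\<^sup>2))) \<partial>lborel)
        = (\<integral>\<^sup>+ t. ennreal ((cmod ((s + t) - (s - t)))\<^sup>2 / 2 * U (s + t) * U (s - t)) \<partial>lborel)"
    proof (rule nn_integral_cong)
      fix t
      have "(cmod ((s + t) - (s - t)))\<^sup>2 / 2 = 2 * (cmod t)\<^sup>2"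
        by (simp add: norm_mult power_mult_distrib flip: mult_2)
      then show "?E * ennreal (2 * (cmod t)\<^sup>2 * ((cmod (h s t))\<^sup>2 * exp (- 2 * (cmod t)\<^sup>2)))
        = ennreal ((cmod ((s + t) - (s - t)))\<^sup>2 / 2 * U (s + t) * U (s - t))"
        by (simp only: mult.assoc UU) (simp add: ennreal_mult'[symmetric] mult_ac)
    qed
    finally show "(\<integral>\<^sup>+ t. ennreal (3 * (U (s + t) * U (s - t))) \<partial>lborel) \<le> ennreal (pi * (U s)\<^sup>2)
      + (\<integral>\<^sup>+ t. ennreal ((cmod ((s + t) - (s - t)))\<^sup>2 / 2 * U (s + t) * U (s - t)) \<partial>lborel)" .
  qed simp
  also have "\<dots> = 4 * (\<integral>\<^sup>+ s. ennreal pi * ennreal ((U s)\<^sup>2) \<partial>lborel)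
      + 4 * (\<integral>\<^sup>+ s. \<integral>\<^sup>+ t. ennreal ((cmod ((s + t) - (s - t)))\<^sup>2 / 2 * U (s + t) * U (s - t)) \<partial>lborel \<partial>lborel)"
    by (subst nn_integral_add) (auto simp: distrib_left ennreal_mult')
  \<comment> \<open>The constant 4 pi is the Jacobian 4 times the pi of the mode-0 term.\<close>
  also have "4 * (\<integral>\<^sup>+ s. ennreal pi * ennreal ((U s)\<^sup>2) \<partial>lborel) = ennreal (4 * pi) * (\<integral>\<^sup>+ z. ennreal ((U z)\<^sup>2) \<partial>lborel)"
    by (subst nn_integral_cmult) (auto simp: ennreal_mult' mult.assoc)
  also have "4 * (\<integral>\<^sup>+ s. \<integral>\<^sup>+ t. ennreal ((cmod ((s + t) - (s - t)))\<^sup>2 / 2 * U (s + t) * U (s - t)) \<partial>lborel \<partial>lborel)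
      = (\<integral>\<^sup>+ w. \<integral>\<^sup>+ z. ennreal ((cmod (z - w))\<^sup>2 / 2 * U z * U w) \<partial>lborel \<partial>lborel)"
    by (rule nn_integral_sum_diff[symmetric]) (simp add: case_prod_unfold)
  finally show ?thesis .
qed

text \<open>For a probability density with finite second moment p and centre of mass q, half the
  mean squared distance of two independent points is p - |q|^2; the term |q|^2 is dropped. If the
  second moment is infinite there is nothing to show.\<close>

lemma nn_integral_square_dist_le:
  fixes U :: "complex \<Rightarrow> real"
  assumes U[measurable]: "U \<in> borel_measurable borel" and U0: "\<And>z. U z \<ge> 0"
    and M: "(\<integral>\<^sup>+ z. ennreal (U z) \<partial>lborel) = 1"
  shows "(\<integral>\<^sup>+ w. \<integral>\<^sup>+ z. ennreal ((cmod (z - w))\<^sup>2 / 2 * U z * U w) \<partial>lborel \<partial>lborel)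
    \<le> (\<integral>\<^sup>+ z. ennreal ((cmod z)\<^sup>2 * U z) \<partial>lborel)" (is "?D \<le> ?P")
proof (cases "?P = \<infinity>")
  case False
  have iU: "integrable lborel U"
    by (rule integrableI_nonneg) (auto simp: U0 M)
  have IU: "(LINT z|lborel. U z) = 1"
    using M nn_integral_eq_integral[OF iU] U0 by simp
  have iP: "integrable lborel (\<lambda>z. (cmod z)\<^sup>2 * U z)"
    by (rule integrableI_nonneg) (use False in \<open>auto simp: U0 less_top\<close>)
  define p where "p = (LINT z|lborel. (cmod z)\<^sup>2 * U z)"
  have P: "?P = ennreal p"
    unfolding p_def by (rule nn_integral_eq_integral[OF iP]) (simp add: U0)
  have iQ: "integrable lborel (\<lambda>z. U z *\<^sub>R z)"
  proof (rule Bochner_Integration.integrable_bound[OF Bochner_Integration.integrable_add[OF iU iP]])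
    \<comment> \<open>The first moment is dominated by mass plus second moment, so the centre of
      mass exists.\<close>
    have "2 * cmod z \<le> (cmod z)\<^sup>2 + 1" for z :: complex
      using zero_le_power2[of "cmod z - 1"] by (simp add: power2_diff)
    then have "cmod z \<le> 1 + (cmod z)\<^sup>2" for z :: complex
      using norm_ge_zero[of z] by (smt (verit))
    then have "U z * cmod z \<le> U z + (cmod z)\<^sup>2 * U z" for z
      using mult_left_mono[OF \<open>cmod z \<le> 1 + (cmod z)\<^sup>2\<close> U0[of z]] by (simp add: algebra_simps)
    then show "AE z in lborel. norm (U z *\<^sub>R z) \<le> norm (U z + (cmod z)\<^sup>2 * U z)"
      by (simp add: U0)
  qed auto
  define q where "q = (LINT z|lborel. U z *\<^sub>R z)"
  have expand: "(cmod (z - w))\<^sup>2 / 2 * U z * U w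
      = U w / 2 * ((cmod z)\<^sup>2 * U z) + (cmod w)\<^sup>2 * U w / 2 * U z - (U w *\<^sub>R w) \<bullet> (U z *\<^sub>R z)" for z w
    by (simp add: power2_norm_eq_inner inner_diff_left inner_diff_right inner_commute field_simps)
  have lint: "(LINT z|lborel. (cmod (z - w))\<^sup>2 / 2 * U z * U w)
      = U w / 2 * p + (cmod w)\<^sup>2 * U w / 2 - (U w *\<^sub>R w) \<bullet> q" for w
  proof -
    have "(LINT z|lborel. (cmod (z - w))\<^sup>2 / 2 * U z * U w)
        = U w / 2 * p + (cmod w)\<^sup>2 * U w / 2 * 1 - (U w *\<^sub>R w) \<bullet> q"
      unfolding expand p_def q_def IU[symmetric] using iP iU iQ
      by (simp add: Bochner_Integration.integral_diff Bochner_Integration.integral_add del: inner_scaleR_left inner_scaleR_right)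
    then show ?thesis by simp
  qed
  have inner: "(\<integral>\<^sup>+ z. ennreal ((cmod (z - w))\<^sup>2 / 2 * U z * U w) \<partial>lborel)
      = ennreal (U w / 2 * p + (cmod w)\<^sup>2 * U w / 2 - (U w *\<^sub>R w) \<bullet> q)" for w
    unfolding lint[symmetric]
  proof (rule nn_integral_eq_integral)
    show "integrable lborel (\<lambda>z. (cmod (z - w))\<^sup>2 / 2 * U z * U w)"
      unfolding expand by (intro Bochner_Integration.integrable_add Bochner_Integration.integrable_diff
          integrable_mult_right iP iU integrable_inner_right iQ)
  qed (simp add: U0)
  have nonneg: "0 \<le> U w / 2 * p + (cmod w)\<^sup>2 * U w / 2 - (U w *\<^sub>R w) \<bullet> q" for w
    unfolding lint[symmetric] by (rule Bochner_Integration.integral_nonneg) (simp add: U0)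
  have "?D = ennreal (LINT w|lborel. U w / 2 * p + (cmod w)\<^sup>2 * U w / 2 - (U w *\<^sub>R w) \<bullet> q)"
    unfolding inner using iP iU iQ nonneg
    by (intro nn_integral_eq_integral)
       (auto intro!: Bochner_Integration.integrable_add Bochner_Integration.integrable_diff simp del: inner_scaleR_left inner_scaleR_right)
  also have "(LINT w|lborel. U w / 2 * p + (cmod w)\<^sup>2 * U w / 2 - (U w *\<^sub>R w) \<bullet> q)
      = (LINT w|lborel. U w) / 2 * p + (LINT w|lborel. (cmod w)\<^sup>2 * U w) / 2 - (LINT w|lborel. U w *\<^sub>R w) \<bullet> q"
    using iP iU iQ
    by (simp add: Bochner_Integration.integral_diff Bochner_Integration.integral_add del: inner_scaleR_left inner_scaleR_right)
  also have "\<dots> = p - q \<bullet> q" unfolding IU p_def[symmetric] q_def[symmetric] by simp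
  also have "ennreal \<dots> \<le> ennreal p" by (rule ennreal_leI) simp
  finally show ?thesis by (simp add: P)
qed simp

section \<open>The energy in terms of nonnegative integrals\<close>

lemma ext_integral_nonneg:
  assumes "\<And>z. g z \<ge> 0"
  shows "ext_integral g = enn2ereal (\<integral>\<^sup>+ z. ennreal (g z) \<partial>lborel)"
proof -
  have "ennreal (- g z) = 0" for z using assms[of z] by (simp add: ennreal_neg)
  then show ?thesis by (simp add: ext_integral_def zero_ennreal.rep_eq)
qed

text \<open>The second moment may be infinite, so the integrand cannot be split by linearity.
  Instead the positive part plus |u|^2 equals the negative part plus |z|^2 |u|^2 pointwise; the
  negative part has integral at most 1 and can be cancelled after integration.\<close>

lemma fock_P_eq:
  assumes [measurable]: "u \<in> borel_measurable borel"
    and M: "(\<integral>\<^sup>+ z. ennreal ((cmod (u z))\<^sup>2) \<partial>lborel) = 1"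
  shows "fock_P u = enn2ereal (\<integral>\<^sup>+ z. ennreal ((cmod z)\<^sup>2 * (cmod (u z))\<^sup>2) \<partial>lborel) - 1"
proof -
  let ?g = "\<lambda>z. ((cmod z)\<^sup>2 - 1) * (cmod (u z))\<^sup>2"
  define A where "A = (\<integral>\<^sup>+ z. ennreal (?g z) \<partial>lborel)"
  define B where "B = (\<integral>\<^sup>+ z. ennreal (- ?g z) \<partial>lborel)"
  define P where "P = (\<integral>\<^sup>+ z. ennreal ((cmod z)\<^sup>2 * (cmod (u z))\<^sup>2) \<partial>lborel)"
  have "B \<le> 1" unfolding B_def M[symmetric]
    by (intro nn_integral_mono ennreal_leI) (simp add: algebra_simps)
  then have "B \<noteq> \<infinity>" by (auto simp: top_unique)
  have "A + 1 = (\<integral>\<^sup>+ z. ennreal (?g z) + ennreal ((cmod (u z))\<^sup>2) \<partial>lborel)"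
    unfolding A_def M[symmetric] by (subst nn_integral_add) auto
  also have "\<dots> = (\<integral>\<^sup>+ z. ennreal (- ?g z) + ennreal ((cmod z)\<^sup>2 * (cmod (u z))\<^sup>2) \<partial>lborel)"
  proof (rule nn_integral_cong)
    fix z
    show "ennreal (?g z) + ennreal ((cmod (u z))\<^sup>2) = ennreal (- ?g z) + ennreal ((cmod z)\<^sup>2 * (cmod (u z))\<^sup>2)"
    proof (cases "?g z \<ge> 0")
      case True
      then show ?thesis by (simp add: ennreal_neg algebra_simps flip: ennreal_plus)
    next
      case False
      then have "ennreal (?g z) = 0" "0 \<le> - ?g z" by (auto intro: ennreal_neg)
      then show ?thesis by (simp add: algebra_simps flip: ennreal_plus)
    qed
  qed
  also have "\<dots> = B + P" unfolding B_def P_def by (subst nn_integral_add) auto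
  finally have "enn2ereal A + 1 = enn2ereal B + enn2ereal P"
    by (metis one_ennreal.rep_eq plus_ennreal.rep_eq)
  moreover have "enn2ereal B \<noteq> \<infinity>" using \<open>B \<noteq> \<infinity>\<close> by simp
  moreover have "enn2ereal A \<ge> 0" "enn2ereal B \<ge> 0" "enn2ereal P \<ge> 0" by simp_all
  ultimately have "enn2ereal A - enn2ereal B = enn2ereal P - 1"
    by (cases "enn2ereal A"; cases "enn2ereal B"; cases "enn2ereal P") (auto simp: one_ereal_def)
  then show ?thesis by (simp add: fock_P_def ext_integral_def A_def B_def P_def)
qed

lemma fock_G_eq:
  assumes m: "u \<in> borel_measurable borel"
    and M: "(\<integral>\<^sup>+ z. ennreal ((cmod (u z))\<^sup>2) \<partial>lborel) = 1"
  shows "fock_G \<mu> u = ereal (2 * pi) * enn2ereal (\<integral>\<^sup>+ z. ennreal (cmod (u z) ^ 4) \<partial>lborel)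
    + ereal \<mu> * (enn2ereal (\<integral>\<^sup>+ z. ennreal ((cmod z)\<^sup>2 * (cmod (u z))\<^sup>2) \<partial>lborel) - 1)"
  by (simp add: fock_G_def fock_H_def ext_integral_nonneg fock_P_eq[OF assms] mult.assoc[symmetric])

section \<open>Energy bounds in the Bargmann-Fock space\<close>

lemma power4_eq_power2_power2: "x ^ 4 = (x\<^sup>2)\<^sup>2" for x :: "'a::monoid_mult"
  by (simp flip: power_mult)

context
  fixes f u :: "complex \<Rightarrow> complex"
  assumes hol: "f holomorphic_on UNIV"
    and u: "\<And>z. u z = of_real (exp (- (cmod z)\<^sup>2 / 2)) * f z"
begin

lemma fock_borel_measurable: "u \<in> borel_measurable borel"
proof -
  have [measurable]: "f \<in> borel_measurable borel"
    by (rule holomorphic_UNIV_borel_measurable[OF hol])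
  show ?thesis unfolding u[abs_def] by measurable
qed

lemma fock_cmod_square: "(cmod (u z))\<^sup>2 = (cmod (f z))\<^sup>2 * exp (- (cmod z)\<^sup>2)"
proof -
  have "(exp (- (cmod z)\<^sup>2 / 2))\<^sup>2 = exp (- (cmod z)\<^sup>2)"
    by (simp add: exp_double[symmetric])
  then show ?thesis by (simp add: u norm_mult power_mult_distrib)
qed

lemma fock_nn_integral_moment:
  assumes a: "\<And>z. (\<lambda>n. a n * z ^ n) sums f z"
  shows "(\<integral>\<^sup>+ z. ennreal (cmod z ^ (2 * j) * (cmod (u z))\<^sup>2) \<partial>lborel)
    = (\<Sum>n. ennreal ((cmod (a n))\<^sup>2 * (pi * fact (n + j))))"
  using nn_integral_power_series_gaussian[OF a holomorphic_UNIV_borel_measurable[OF hol] zero_less_one, of j]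
  by (simp only: fock_cmod_square mult.assoc minus_mult_left[symmetric] mult_1_left power_one div_by_1)

text \<open>Since |u|^4 = |f^2|^2 exp(-2|z|^2), the quartic energy is a weighted square norm of the
  entire function f^2.\<close>

lemma fock_nn_integral_power4:
  assumes b: "\<And>z. (\<lambda>n. b n * z ^ n) sums (f z)\<^sup>2"
  shows "(\<integral>\<^sup>+ z. ennreal (cmod (u z) ^ 4) \<partial>lborel)
    = (\<Sum>n. ennreal ((cmod (b n))\<^sup>2 * (pi * fact n / 2 ^ (n + 1))))"
proof -
  have u4: "cmod (u z) ^ 4 = (cmod ((f z)\<^sup>2))\<^sup>2 * exp (- 2 * (cmod z)\<^sup>2)" for z
    unfolding power4_eq_power2_power2 fock_cmod_square
    by (simp add: norm_power power_mult_distrib exp_double[symmetric])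
  have m: "(\<lambda>z. (f z)\<^sup>2) \<in> borel_measurable borel"
    by (intro holomorphic_UNIV_borel_measurable holomorphic_intros hol)
  show ?thesis
    \<comment> \<open>The last instantiation is the numeral 2, which fixes the Gaussian exponent
      through \<open>zero_less_numeral\<close>.\<close>
    using nn_integral_power_series_gaussian[OF b m zero_less_numeral, of 0 "num.Bit0 num.One"]
    by (simp only: u4 mult_0_right power_0 mult_1 add_0_right)
qed

lemma fock_lower_bound:
  assumes M: "(\<integral>\<^sup>+ z. ennreal ((cmod (u z))\<^sup>2) \<partial>lborel) = 1"
  shows "3 \<le> ennreal (4 * pi) * (\<integral>\<^sup>+ z. ennreal (cmod (u z) ^ 4) \<partial>lborel)
    + (\<integral>\<^sup>+ z. ennreal ((cmod z)\<^sup>2 * (cmod (u z))\<^sup>2) \<partial>lborel)"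
proof -
  note [measurable] = fock_borel_measurable
  have "3 \<le> ennreal (4 * pi) * (\<integral>\<^sup>+ z. ennreal (cmod (u z) ^ 4) \<partial>lborel)
    + (\<integral>\<^sup>+ w. \<integral>\<^sup>+ z. ennreal ((cmod (z - w))\<^sup>2 / 2 * (cmod (u z))\<^sup>2 * (cmod (u w))\<^sup>2) \<partial>lborel \<partial>lborel)"
    using two_particle_inequality[OF hol, folded fock_cmod_square]
    by (simp only: M power4_eq_power2_power2 mult_1_right)
  also have "\<dots> \<le> ennreal (4 * pi) * (\<integral>\<^sup>+ z. ennreal (cmod (u z) ^ 4) \<partial>lborel)
    + (\<integral>\<^sup>+ z. ennreal ((cmod z)\<^sup>2 * (cmod (u z))\<^sup>2) \<partial>lborel)"
    by (intro add_left_mono nn_integral_square_dist_le M) auto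
  finally show ?thesis .
qed

text \<open>With \<open>b n\<close> the mass in mode n, (n + 1)! = n! + n n! gives P = 1 + sum of n
  \<open>b n\<close>. This sum is nonnegative, and it vanishes only if all mass sits in mode
  0.\<close>

lemma fock_second_moment:
  assumes M: "(\<integral>\<^sup>+ z. ennreal ((cmod (u z))\<^sup>2) \<partial>lborel) = 1"
  defines "P \<equiv> \<integral>\<^sup>+ z. ennreal ((cmod z)\<^sup>2 * (cmod (u z))\<^sup>2) \<partial>lborel"
  shows "1 \<le> P" and "P = 1 \<Longrightarrow> f z = f 0"
proof -
  define a where "a n = (deriv ^^ n) f 0 / fact n" for n
  have a: "(\<lambda>n. a n * z ^ n) sums f z" for z
    using holomorphic_power_series[of f 0 "cmod z + 1" z] hol
    by (auto simp: a_def intro: holomorphic_on_subset)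
  define b where "b n = (cmod (a n))\<^sup>2 * (pi * fact n)" for n
  have b0: "b n \<ge> 0" for n by (simp add: b_def)
  have "P = (\<Sum>n. ennreal ((cmod (a n))\<^sup>2 * (pi * fact (n + 1))))"
    using fock_nn_integral_moment[OF a, of 1] by (simp add: P_def)
  also have "\<dots> = (\<Sum>n. ennreal (b n) + ennreal (n * b n))"
    using b0 by (intro suminf_cong) (simp add: b_def algebra_simps flip: ennreal_plus)
  also have "\<dots> = (\<Sum>n. ennreal (b n)) + (\<Sum>n. ennreal (n * b n))"
    by (rule suminf_add[symmetric]) auto
  also have "(\<Sum>n. ennreal (b n)) = 1"
    using fock_nn_integral_moment[OF a, of 0] M by (simp add: b_def)
  finally have P: "P = 1 + (\<Sum>n. ennreal (n * b n))" .
  show "1 \<le> P" by (simp add: P)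
  assume "P = 1"
  then have "1 + (\<Sum>n. ennreal (n * b n)) = 1 + 0" using P by simp
  then have "(\<Sum>n. ennreal (n * b n)) = 0"
    unfolding ennreal_add_left_cancel by simp
  then have "ennreal (n * b n) = 0" for n
    by (subst (asm) suminf_eq_zero_iff) auto
  then have a0: "a n = 0" if "n > 0" for n
  proof -
    have "b n \<le> 0" using \<open>ennreal (n * b n) = 0\<close> that by (simp add: ennreal_eq_0_iff mult_le_0_iff)
    then have "b n = 0" using b0[of n] by simp
    then show ?thesis by (simp add: b_def)
  qed
  have "(\<lambda>n. a n * w ^ n) sums (\<Sum>n\<in>{0}. a n * w ^ n)" for w
    by (rule sums_finite) (use a0 in auto)
  then have "(\<lambda>n. a n * w ^ n) sums a 0" for w by simp
  then have "f w = a 0" for w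
    by (rule sums_unique2[OF a])
  then show "f z = f 0" by simp
qed

lemma fock_member:
  assumes M: "(\<integral>\<^sup>+ z. ennreal ((cmod (u z))\<^sup>2) \<partial>lborel) = 1"
  shows "u \<in> bargmann_fock" and "fock_M u = 1"
proof -
  note [measurable] = fock_borel_measurable
  have i: "integrable lborel (\<lambda>z. (cmod (u z))\<^sup>2)"
    by (rule integrableI_nonneg) (auto simp: M)
  then show "u \<in> bargmann_fock"
    using hol u by (auto simp: bargmann_fock_def)
  show "fock_M u = 1"
    using M nn_integral_eq_integral[OF i] by (simp add: fock_M_def)
qed

end

lemma nn_integral_fock_M:
  assumes "u \<in> bargmann_fock" and "fock_M u = 1"
  shows "(\<integral>\<^sup>+ z. ennreal ((cmod (u z))\<^sup>2) \<partial>lborel) = 1"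
proof -
  have i: "integrable lborel (\<lambda>z. (cmod (u z))\<^sup>2)"
    using assms(1) by (simp add: bargmann_fock_def)
  show ?thesis
    using nn_integral_eq_integral[OF i] assms(2) by (simp add: fock_M_def)
qed

text \<open>Let p be the second moment and q the integral of |u|^4. The bound 3 \<le> 4 pi q + p
  says 1 \<le> 2 pi q + (p - 1) / 2. What remains of the energy is (\<mu> - 1/2)(p - 1), which is
  nonnegative as p \<ge> 1, and energy at most 1 forces p = 1.\<close>

lemma fock_G_lower_bound:
  assumes u: "u \<in> bargmann_fock" "fock_M u = 1" and \<mu>: "\<mu> > 1 / 2"
  shows "1 \<le> fock_G \<mu> u"
    and "fock_G \<mu> u \<le> 1 \<Longrightarrow> \<exists>c. \<forall>z. u z = of_real (exp (- (cmod z)\<^sup>2 / 2)) * c"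
proof -
  obtain f where hol: "f holomorphic_on UNIV"
    and f: "\<And>z. u z = of_real (exp (- (cmod z)\<^sup>2 / 2)) * f z"
    using u(1) by (auto simp: bargmann_fock_def)
  note M = nn_integral_fock_M[OF u]
  define P where "P = (\<integral>\<^sup>+ z. ennreal ((cmod z)\<^sup>2 * (cmod (u z))\<^sup>2) \<partial>lborel)"
  define Q where "Q = (\<integral>\<^sup>+ z. ennreal (cmod (u z) ^ 4) \<partial>lborel)"
  have G: "fock_G \<mu> u = ereal (2 * pi) * enn2ereal Q + ereal \<mu> * (enn2ereal P - 1)"
    unfolding P_def Q_def by (rule fock_G_eq[OF fock_borel_measurable[OF hol f] M])
  have lb: "3 \<le> ennreal (4 * pi) * Q + P"
    unfolding P_def Q_def by (rule fock_lower_bound[OF hol f M])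
  have P1: "1 \<le> P"
    unfolding P_def by (rule fock_second_moment(1)[OF hol f M])
  \<comment> \<open>Since p \<ge> 1 and \<mu> > 0, no infinite term can be cancelled; finite energy
    therefore makes both moments real.\<close>
  have G_infinite: "fock_G \<mu> u = \<infinity>" if "P = \<infinity> \<or> Q = \<infinity>"
  proof (cases "P = \<infinity>")
    case True
    have "0 \<le> ereal (2 * pi) * enn2ereal Q" by simp
    moreover have "ereal \<mu> * (enn2ereal P - 1) = \<infinity>" using True \<mu> by simp
    ultimately show ?thesis unfolding G by simp
  next
    case False
    then obtain p where "P = ennreal p" "p \<ge> 0" by (cases P) auto
    then show ?thesis using False that \<mu> unfolding G by (simp add: one_ereal_def)
  qed
  have real: "\<exists>p q. P = ennreal p \<and> 1 \<le> p \<and> 3 \<le> 4 * pi * q + p \<and> fock_G \<mu> u = ereal (2 * pi * q + \<mu> * (p - 1))"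
    if fin: "fock_G \<mu> u \<noteq> \<infinity>"
  proof -
    obtain p where p: "P = ennreal p" "p \<ge> 0" using G_infinite fin by (cases P) auto
    obtain q where q: "Q = ennreal q" "q \<ge> 0" using G_infinite fin by (cases Q) auto
    have "1 \<le> p" using P1 p by simp
    moreover have "3 \<le> 4 * pi * q + p"
      using lb p q by (simp flip: ennreal_mult' ennreal_plus ennreal_numeral)
    moreover have "fock_G \<mu> u = ereal (2 * pi * q + \<mu> * (p - 1))"
      using p q by (simp add: G one_ereal_def)
    ultimately show ?thesis using p by blast
  qed
  have mono: "(p - 1) / 2 \<le> \<mu> * (p - 1)" if "1 \<le> p" for p
    using that \<mu> mult_right_mono[of "1/2" \<mu> "p - 1"] by simp
  show "1 \<le> fock_G \<mu> u"
  proof (cases "fock_G \<mu> u = \<infinity>")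
    case False
    then obtain p q where "1 \<le> p" "3 \<le> 4 * pi * q + p" "fock_G \<mu> u = ereal (2 * pi * q + \<mu> * (p - 1))"
      using real by blast
    then show ?thesis using mono[of p] by (simp add: one_ereal_def)
  qed simp
  assume le: "fock_G \<mu> u \<le> 1"
  then have "fock_G \<mu> u \<noteq> \<infinity>" by auto
  then obtain p q where pq: "P = ennreal p" "1 \<le> p" "3 \<le> 4 * pi * q + p"
    "fock_G \<mu> u = ereal (2 * pi * q + \<mu> * (p - 1))"
    using real by blast
  have "2 * pi * q + \<mu> * (p - 1) \<le> 1" using le pq by (simp add: one_ereal_def)
  then have "(\<mu> - 1 / 2) * (p - 1) \<le> 0" using pq(3) by (simp add: field_simps)
  moreover have "0 < (\<mu> - 1 / 2) * (p - 1)" if "p > 1"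
    by (rule mult_pos_pos) (use that \<mu> in auto)
  ultimately have "p = 1" using pq(2) by fastforce
  then have "f z = f 0" for z
    using fock_second_moment(2)[OF hol f M] pq by (simp add: P_def)
  then show "\<exists>c. \<forall>z. u z = of_real (exp (- (cmod z)\<^sup>2 / 2)) * c"
    using f by metis
qed

section \<open>Two-mode trial states and the energy of the Gaussian\<close>

definition fock_trial :: "real \<Rightarrow> real \<Rightarrow> complex \<Rightarrow> complex" where
  "fock_trial \<alpha> \<beta> z = of_real (exp (- (cmod z)\<^sup>2 / 2)) * (of_real \<alpha> + of_real \<beta> * z\<^sup>2)"

text \<open>The constants are Gaussian moments: 2 = 2! and 6 = 3! for z^2, and 3/2 = 4!/2^4 for the
  z^4 term of f^2. Degree two is the lowest useful one: mass y moved from the Gaussian to z changes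
  the energy by \<mu> y to first order, an increase.\<close>

lemma fock_trial_properties:
  assumes M: "pi * (\<alpha>\<^sup>2 + 2 * \<beta>\<^sup>2) = 1"
  shows "fock_trial \<alpha> \<beta> \<in> bargmann_fock" and "fock_M (fock_trial \<alpha> \<beta>) = 1"
    and "fock_G \<mu> (fock_trial \<alpha> \<beta>)
      = ereal (pi\<^sup>2 * (\<alpha> ^ 4 + 2 * \<alpha>\<^sup>2 * \<beta>\<^sup>2 + 3 / 2 * \<beta> ^ 4) + \<mu> * (pi * (\<alpha>\<^sup>2 + 6 * \<beta>\<^sup>2) - 1))"
proof -
  let ?f = "\<lambda>z::complex. of_real \<alpha> + of_real \<beta> * z\<^sup>2"
  have hol: "?f holomorphic_on UNIV" by (intro holomorphic_intros)
  define a where "a n = complex_of_real (if n = 0 then \<alpha> else if n = 2 then \<beta> else 0)" for n :: nat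
  define b where "b n = complex_of_real (if n = 0 then \<alpha>\<^sup>2 else if n = 2 then 2 * \<alpha> * \<beta> else if n = 4 then \<beta>\<^sup>2 else 0)" for n :: nat
  have a: "(\<lambda>n. a n * z ^ n) sums ?f z" for z
    using sums_finite[of "{0, 2}" "\<lambda>n. a n * z ^ n"] by (auto simp: a_def)
  have b: "(\<lambda>n. b n * z ^ n) sums (?f z)\<^sup>2" for z
    using sums_finite[of "{0, 2, 4}" "\<lambda>n. b n * z ^ n"]
    by (auto simp: b_def power2_eq_square algebra_simps power4_eq_xxxx)
  note moment = fock_nn_integral_moment[OF hol fock_trial_def a]
  have mom: "(\<integral>\<^sup>+ z. ennreal (cmod z ^ (2 * j) * (cmod (fock_trial \<alpha> \<beta> z))\<^sup>2) \<partial>lborel)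
      = ennreal (pi * (fact j * \<alpha>\<^sup>2 + fact (2 + j) * \<beta>\<^sup>2))" for j
    unfolding moment
    by (subst suminf_finite[of "{0, 2}"]) (auto simp: a_def algebra_simps simp flip: ennreal_plus)
  have M': "(\<integral>\<^sup>+ z. ennreal ((cmod (fock_trial \<alpha> \<beta> z))\<^sup>2) \<partial>lborel) = 1"
    using mom[of 0] M by simp
  have P: "(\<integral>\<^sup>+ z. ennreal ((cmod z)\<^sup>2 * (cmod (fock_trial \<alpha> \<beta> z))\<^sup>2) \<partial>lborel) = ennreal (pi * (\<alpha>\<^sup>2 + 6 * \<beta>\<^sup>2))"
    using mom[of 1] by (simp add: fact_numeral)
  have Q: "(\<integral>\<^sup>+ z. ennreal (cmod (fock_trial \<alpha> \<beta> z) ^ 4) \<partial>lborel)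
      = ennreal (pi / 2 * (\<alpha> ^ 4 + 2 * \<alpha>\<^sup>2 * \<beta>\<^sup>2 + 3 / 2 * \<beta> ^ 4))"
  proof -
    have "(\<integral>\<^sup>+ z. ennreal (cmod (fock_trial \<alpha> \<beta> z) ^ 4) \<partial>lborel)
        = (\<Sum>n\<in>{0, 2, 4}. ennreal ((cmod (b n))\<^sup>2 * (pi * fact n / 2 ^ (n + 1))))"
      unfolding fock_nn_integral_power4[OF hol fock_trial_def b]
      by (rule suminf_finite) (auto simp: b_def)
    also have "\<dots> = ennreal (\<Sum>n\<in>{0, 2, 4}. (cmod (b n))\<^sup>2 * (pi * fact n / 2 ^ (n + 1)))"
      by (rule sum_ennreal) simp
    also have "(\<Sum>n\<in>{0, 2, 4}. (cmod (b n))\<^sup>2 * (pi * fact n / 2 ^ (n + 1)))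
        = (\<alpha>\<^sup>2)\<^sup>2 * (pi / 2) + (2 * \<alpha> * \<beta>)\<^sup>2 * (pi * 2 / 8) + (\<beta>\<^sup>2)\<^sup>2 * (pi * 24 / 32)"
      by (simp add: b_def fact_numeral mult.commute del: of_real_power of_real_mult)
    also have "\<dots> = pi / 2 * (\<alpha> ^ 4 + 2 * \<alpha>\<^sup>2 * \<beta>\<^sup>2 + 3 / 2 * \<beta> ^ 4)"
      unfolding power4_eq_power2_power2 power_mult_distrib by (simp add: algebra_simps)
    finally show ?thesis .
  qed
  show "fock_trial \<alpha> \<beta> \<in> bargmann_fock" "fock_M (fock_trial \<alpha> \<beta>) = 1"
    by (rule fock_member[OF hol fock_trial_def M'])+
  show "fock_G \<mu> (fock_trial \<alpha> \<beta>)
      = ereal (pi\<^sup>2 * (\<alpha> ^ 4 + 2 * \<alpha>\<^sup>2 * \<beta>\<^sup>2 + 3 / 2 * \<beta> ^ 4) + \<mu> * (pi * (\<alpha>\<^sup>2 + 6 * \<beta>\<^sup>2) - 1))"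
  proof -
    have "0 \<le> pi * (\<alpha>\<^sup>2 + 6 * \<beta>\<^sup>2)" "0 \<le> pi / 2 * (\<alpha> ^ 4 + 2 * \<alpha>\<^sup>2 * \<beta>\<^sup>2 + 3 / 2 * \<beta> ^ 4)"
      by simp_all
    note nonneg = this
    show ?thesis
      unfolding fock_G_eq[OF fock_borel_measurable[OF hol fock_trial_def] M'] P Q nonneg[THEN enn2ereal_ennreal]
      by (simp add: one_ereal_def power2_eq_square mult.assoc[symmetric])
  qed
qed

lemma gaussian0_eq_fock_trial: "gaussian0 = fock_trial (1 / sqrt pi) 0"
  by (auto simp: gaussian0_def fock_trial_def)

lemma gaussian0_properties:
  shows "gaussian0 \<in> bargmann_fock" and "fock_M gaussian0 = 1" and "fock_G \<mu> gaussian0 = 1"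
proof -
  have M: "pi * ((1 / sqrt pi)\<^sup>2 + 2 * 0\<^sup>2) = 1" by (simp add: power_divide)
  have "(1 / sqrt pi) ^ 4 = (1 / pi)\<^sup>2"
    unfolding power4_eq_power2_power2 by (simp add: power_divide)
  then show "gaussian0 \<in> bargmann_fock" "fock_M gaussian0 = 1" "fock_G \<mu> gaussian0 = 1"
    unfolding gaussian0_eq_fock_trial fock_trial_properties[OF M]
    by (simp_all add: fock_trial_properties(1,2)[OF M] power_divide one_ereal_def)
qed

theorem theorem1p1:
  shows "(\<forall>\<mu>::real. \<mu> > 1 / 2 \<longrightarrow>
            global_minimizer \<mu> gaussian0 \<and>
            (\<forall>u. global_minimizer \<mu> u \<longrightarrow>
               (\<exists>\<gamma>::real. u = (\<lambda>z. exp (\<i> * of_real \<gamma>) * gaussian0 z)))) \<and>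
         (\<forall>\<mu>::real. 0 < \<mu> \<and> \<mu> < 1 / 2 \<longrightarrow> \<not> global_minimizer \<mu> gaussian0)"
proof (intro conjI allI impI)
  fix \<mu> :: real assume \<mu>: "\<mu> > 1 / 2"
  show "global_minimizer \<mu> gaussian0"
    using fock_G_lower_bound(1)[OF _ _ \<mu>] by (simp add: global_minimizer_def gaussian0_properties)
  fix u assume "global_minimizer \<mu> u"
  then have u: "u \<in> bargmann_fock" "fock_M u = 1" and "fock_G \<mu> u \<le> 1"
    using gaussian0_properties by (auto simp: global_minimizer_def)
  then obtain c where c: "\<And>z. u z = of_real (exp (- (cmod z)\<^sup>2 / 2)) * c"
    using fock_G_lower_bound(2)[OF u \<mu>] by blast
  have ug: "u = (\<lambda>z. (c * sqrt pi) * gaussian0 z)"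
    by (auto simp: c gaussian0_def)
  \<comment> \<open>Comparing masses leaves only the phase of the constant factor; its argument is
    the required angle.\<close>
  have "fock_M u = (cmod (c * sqrt pi))\<^sup>2 * fock_M gaussian0"
    unfolding fock_M_def ug norm_mult power_mult_distrib by (rule integral_mult_right_zero)
  then have "cmod (c * sqrt pi) = 1"
    using u gaussian0_properties(2) by (simp add: power2_eq_1_iff del: norm_mult norm_eq_1)
      (smt (verit) norm_ge_zero)
  then have "c * sqrt pi = exp (\<i> * of_real (Arg (c * sqrt pi)))"
    using Arg_eq[of "c * sqrt pi"] by force
  with ug show "\<exists>\<gamma>::real. u = (\<lambda>z. exp (\<i> * of_real \<gamma>) * gaussian0 z)" by metis
next
  fix \<mu> :: real assume \<mu>: "0 < \<mu> \<and> \<mu> < 1 / 2"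
  \<comment> \<open>Moving a fraction y of the mass to z^2 gives energy 1 - (1 - 2\<mu>) y + (3/8)
    y^2. The choice y = 1 - 2\<mu> lies in (0, 1) and yields 1 - (5/8) y^2.\<close>
  define x where "x = 1 - 2 * \<mu>"
  have x: "0 < x" "x < 1" "\<mu> = (1 - x) / 2" using \<mu> by (auto simp: x_def)
  define \<alpha> where "\<alpha> = sqrt ((1 - x) / pi)"
  \<comment> \<open>The extra 2 in the denominator is 2!, since the squared norm of z^2 exp(-|z|^2 /
    2) is 2 pi.\<close>
  define \<beta> where "\<beta> = sqrt (x / (2 * pi))"
  have \<alpha>2: "\<alpha>\<^sup>2 = (1 - x) / pi" and \<beta>2: "\<beta>\<^sup>2 = x / (2 * pi)"
    using x by (simp_all add: \<alpha>_def \<beta>_def)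
  have M: "pi * (\<alpha>\<^sup>2 + 2 * \<beta>\<^sup>2) = 1"
    by (simp add: \<alpha>2 \<beta>2 field_simps)
  have "pi\<^sup>2 * (\<alpha> ^ 4 + 2 * \<alpha>\<^sup>2 * \<beta>\<^sup>2 + 3 / 2 * \<beta> ^ 4) + \<mu> * (pi * (\<alpha>\<^sup>2 + 6 * \<beta>\<^sup>2) - 1) = 1 - 5 / 8 * x\<^sup>2"
    unfolding power4_eq_power2_power2 \<alpha>2 \<beta>2 x(3) by (simp add: power2_eq_square field_simps)
  also have "\<dots> < 1" using x by simp
  finally have "fock_G \<mu> (fock_trial \<alpha> \<beta>) < fock_G \<mu> gaussian0"
    by (simp add: fock_trial_properties[OF M] gaussian0_properties one_ereal_def)
  then show "\<not> global_minimizer \<mu> gaussian0"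
    using fock_trial_properties(1,2)[OF M] by (auto simp: global_minimizer_def not_le)
qed

end
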